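(* Let $G$ be a finite connected graph and $A$ a vertex of $G$. Then the sages lose the hat guessing game on $G$ with the hint $A-1$ if and only if $G$ is a tree.
   Context: Hat guessing game: a sage sits at each vertex of a finite graph; hat colors are $H=\{0,1,2\}$; each sage sees only his neighbours' hats and guesses his own color by a deterministic function of the neighbours' colors, fixed in advance. Hint $A-1$: a color $i\in H$ is announced in advance to everyone and only placements $C$ with $C(A)\ne i$ occur. The sages win with the hint $A-1$ if for every announced $i$ there is a strategy such that every placement with $C(A)\neq i$ has at least one correct guess (by permuting color names, equivalent to this for a single $i$); otherwise they lose. *)

theory Defs
  imports "Graph_Theory.Digraph_Component" "HOL-Library.FuncSet"
begin

text \<open>
  Finite simple graphs are the symmetric digraphs of locale \<open>pair_graph\<close>. In a symmetric
  digraph every edge yields a directed cycle a, b, a of length 2, so the library's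
  predicate \<open>tree\<close> fails for every graph with an edge; for undirected acyclicity only
  cycles of length at least 3 count.
\<close>

definition undirected_tree :: "'a pair_pre_digraph \<Rightarrow> bool" where
  "undirected_tree G \<longleftrightarrow>
     Digraph_Component.connected (with_proj G) \<and>
     \<not> (\<exists>p. pre_digraph.cycle (with_proj G) p \<and> 3 \<le> length p)"

definition hat_colors :: "nat set" where
  "hat_colors = {0, 1, 2}"

definition neighbours :: "'a pair_pre_digraph \<Rightarrow> 'a \<Rightarrow> 'a set" where
  "neighbours G v = {u. (v, u) \<in> parcs G}"

definition placements :: "'a pair_pre_digraph \<Rightarrow> ('a \<Rightarrow> nat) set" where
  "placements G = (pverts G \<rightarrow>\<^sub>E hat_colors)"

definition strategies :: "'a pair_pre_digraph \<Rightarrow> ('a \<Rightarrow> ('a \<Rightarrow> nat) \<Rightarrow> nat) set" where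
  "strategies G =
     Pi (pverts G) (\<lambda>v. Pi (neighbours G v \<rightarrow>\<^sub>E hat_colors) (\<lambda>_. hat_colors))"

definition guesses_correctly ::
  "'a pair_pre_digraph \<Rightarrow> ('a \<Rightarrow> ('a \<Rightarrow> nat) \<Rightarrow> nat) \<Rightarrow> ('a \<Rightarrow> nat) \<Rightarrow> 'a \<Rightarrow> bool" where
  "guesses_correctly G f C v \<longleftrightarrow> f v (restrict C (neighbours G v)) = C v"

text \<open>The strategy may depend on the announced color \<open>i\<close>.\<close>

definition sages_win_hint :: "'a pair_pre_digraph \<Rightarrow> 'a \<Rightarrow> bool" where
  "sages_win_hint G A \<longleftrightarrow>
     (\<forall>i\<in>hat_colors. \<exists>f\<in>strategies G. \<forall>C\<in>placements G.
        C A \<noteq> i \<longrightarrow> (\<exists>v\<in>pverts G. guesses_correctly G f C v))"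

definition sages_lose_hint :: "'a pair_pre_digraph \<Rightarrow> 'a \<Rightarrow> bool" where
  "sages_lose_hint G A \<longleftrightarrow> \<not> sages_win_hint G A"

end

theory Submission
  imports Defs
begin

text \<open>
  Strategies are modelled by functions of the whole placement that depend only on the colors of
  the neighbours, and the game is played on a vertex set \<open>S\<close> for placements satisfying an
  arbitrary condition \<open>P\<close>.

  Trees lose: if \<open>L\<close> is a leaf with neighbour \<open>B\<close>, call a color \<open>b\<close> of \<open>B\<close> bad if \<open>B\<close> guesses \<open>b\<close>
  for each of the (at least two) colors of \<open>L\<close> that \<open>L\<close> fails to guess when it sees \<open>b\<close>. Two bad
  colors share such a color of \<open>L\<close>, so at most one color is bad. Letting \<open>B\<close> guess the bad color, a
  winning strategy survives the removal of \<open>L\<close>. Removing leaves other than \<open>A\<close> ends at the single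
  vertex \<open>A\<close>, where two colors remain possible and the sage loses.

  Graphs with a cycle win: a vertex that has only two possible colors can rule out, by its own
  guess and that of a neighbour, one color of this neighbour. So hints propagate along edges. On a
  path with a hint at both ends the two hints eventually meet in one vertex, which then knows its
  color. On a cycle, the hinted vertex passes a hint to both its neighbours at once, which reduces
  to the path. Finally a hint at any vertex of a connected graph can be passed on to the cycle.
\<close>

section \<open>The game on a set of vertices\<close>

definition local_on :: "'a rel \<Rightarrow> 'a set \<Rightarrow> ('a \<Rightarrow> ('a \<Rightarrow> nat) \<Rightarrow> nat) \<Rightarrow> bool" where
  "local_on E S g \<longleftrightarrow>
     (\<forall>v\<in>S. \<forall>C C'. (\<forall>u\<in>S. (v, u) \<in> E \<longrightarrow> C u = C' u) \<longrightarrow> g v C = g v C')"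

text \<open>Only neighbours inside \<open>S\<close> are seen, so this is the game on the induced
  subgraph, and adding or removing a vertex just changes \<open>S\<close>. A guess outside
  \<open>hat_colors\<close> is allowed but always wrong.\<close>

definition wins_on :: "'a rel \<Rightarrow> 'a set \<Rightarrow> (('a \<Rightarrow> nat) \<Rightarrow> bool) \<Rightarrow> bool" where
  "wins_on E S P \<longleftrightarrow>
     (\<exists>g. local_on E S g \<and> (\<forall>C. (\<forall>u. C u \<in> hat_colors) \<longrightarrow> P C \<longrightarrow> (\<exists>v\<in>S. g v C = C v)))"

text \<open>An undirected cycle as a list of vertices with the first one not repeated, so that it
  can be rotated and its tail is a path.\<close>

definition closed_path :: "'a rel \<Rightarrow> 'a list \<Rightarrow> bool" where
  "closed_path E xs \<longleftrightarrow>
     distinct xs \<and> 3 \<le> length xs \<and> successively (\<lambda>x y. (x, y) \<in> E) xs \<and> (last xs, hd xs) \<in> E"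

lemma local_onD:
  assumes "local_on E S g" "v \<in> S" "\<And>u. u \<in> S \<Longrightarrow> (v, u) \<in> E \<Longrightarrow> C u = C' u"
  shows "g v C = g v C'"
  using assms unfolding local_on_def by blast

lemma wins_onI:
  assumes "\<And>v C C'. v \<in> S \<Longrightarrow> (\<And>u. u \<in> S \<Longrightarrow> (v, u) \<in> E \<Longrightarrow> C u = C' u) \<Longrightarrow> g v C = g v C'"
    and "\<And>C. (\<And>u. C u \<in> hat_colors) \<Longrightarrow> P C \<Longrightarrow> \<exists>v\<in>S. g v C = C v"
  shows "wins_on E S P"
  unfolding wins_on_def local_on_def
proof (intro exI[of _ g] conjI ballI allI impI)
  show "g v C = g v C'" if "v \<in> S" "\<forall>u\<in>S. (v, u) \<in> E \<longrightarrow> C u = C' u" for v C C'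
    by (rule assms(1)) (use that in blast)+
  show "\<exists>v\<in>S. g v C = C v" if "\<forall>u. C u \<in> hat_colors" "P C" for C
    by (rule assms(2)) (use that in blast)+
qed

lemma hat_color_avoiding:
  obtains c where "c \<in> hat_colors" "c \<noteq> x" "c \<noteq> y"
proof -
  have "\<exists>c\<in>hat_colors. c \<noteq> x \<and> c \<noteq> y"
    unfolding hat_colors_def by auto
  then show ?thesis using that by blast
qed

lemma hat_colors_hint:
  assumes "i \<in> hat_colors"
  obtains a b where "a \<noteq> b" "\<And>c. c \<in> hat_colors \<Longrightarrow> c \<noteq> i \<Longrightarrow> c = a \<or> c = b"
proof -
  have "\<exists>a b. a \<noteq> b \<and> (\<forall>c\<in>hat_colors. c \<noteq> i \<longrightarrow> c = a \<or> c = b)"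
    using assms unfolding hat_colors_def
    by (elim insertE emptyE; simp) (metis n_not_Suc_n zero_neq_one zero_neq_numeral)+
  then show ?thesis using that by blast
qed

section \<open>Removing a leaf\<close>

text \<open>Without seeing \<open>L\<close>, \<open>B\<close> guesses the color for which no
  recoloring of \<open>L\<close> makes both \<open>L\<close> and \<open>B\<close> wrong. For any
  other color of \<open>B\<close> such a recoloring exists and preserves \<open>P\<close>, so the
  old strategy is right at a third vertex, which does not see \<open>L\<close>.\<close>

lemma wins_on_remove_leaf:
  assumes win: "wins_on E (insert L S) P"
    and sym: "sym E" and irr: "irrefl E"
    and "L \<notin> S" "B \<in> S"
    and leaf: "\<And>u. u \<in> S \<Longrightarrow> (L, u) \<in> E \<Longrightarrow> u = B"
    and P: "\<And>C x. P C \<Longrightarrow> P (C(L := x))"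
  shows "wins_on E S P"
proof -
  from win obtain g where loc: "local_on E (insert L S) g"
    and g: "\<And>C. \<forall>u. C u \<in> hat_colors \<Longrightarrow> P C \<Longrightarrow> \<exists>v\<in>insert L S. g v C = C v"
    unfolding wins_on_def by blast
  \<comment> \<open>As \<open>L\<close> sees only \<open>B\<close>, its guess at
    \<open>C(B := b)\<close> depends on \<open>b\<close> alone; hence \<open>bad C\<close> depends
    only on colors that \<open>B\<close> sees in \<open>S\<close>.\<close>
  define bad where "bad C b \<longleftrightarrow>
    (\<forall>x\<in>hat_colors. x \<noteq> g L (C(B := b)) \<longrightarrow> g B (C(L := x)) = b)" for C b
  define g' where "g' v C = (if v = B then SOME b. bad C b else g v C)" for v C
  have unique: "b = b'" if "bad C b" "bad C b'" for C b b'
  proof -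
    \<comment> \<open>Of the three colors at most two are guessed by \<open>L\<close>; at the
      remaining one \<open>B\<close> guesses both \<open>b\<close> and \<open>b'\<close>.\<close>
    obtain x where "x \<in> hat_colors" "x \<noteq> g L (C(B := b))" "x \<noteq> g L (C(B := b'))"
      by (rule hat_color_avoiding)
    with that show ?thesis unfolding bad_def by metis
  qed
  show ?thesis
  proof (rule wins_onI[of S E g'])
    fix v and C C' :: "'a \<Rightarrow> nat"
    assume v: "v \<in> S" and eq: "\<And>u. u \<in> S \<Longrightarrow> (v, u) \<in> E \<Longrightarrow> C u = C' u"
    show "g' v C = g' v C'"
    proof (cases "v = B")
      case True
      have "g L (C(B := b)) = g L (C'(B := b))" for b
      proof (rule local_onD[OF loc])
        fix u assume "u \<in> insert L S" "(L, u) \<in> E"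
        then have "u = B" using leaf[of u] irr by (auto simp: irrefl_def)
        then show "(C(B := b)) u = (C'(B := b)) u" by simp
      qed simp
      moreover have "g B (C(L := x)) = g B (C'(L := x))" for x
        by (rule local_onD[OF loc]) (use True eq \<open>B \<in> S\<close> in auto)
      ultimately have "bad C = bad C'" by (simp add: bad_def fun_eq_iff)
      with True show ?thesis by (simp add: g'_def)
    next
      case False
      then have "(v, L) \<notin> E" using leaf v sym by (meson symD)
      then have "g v C = g v C'" using v eq by (intro local_onD[OF loc]) auto
      with False show ?thesis by (simp add: g'_def)
    qed
  next
    fix C :: "'a \<Rightarrow> nat" assume C: "\<And>u. C u \<in> hat_colors" and "P C"
    show "\<exists>v\<in>S. g' v C = C v"
    proof (rule ccontr)
      assume wrong: "\<not> ?thesis"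
      have "\<not> bad C (C B)"
      proof
        assume "bad C (C B)"
        then have "(SOME b. bad C b) = C B" using unique by blast
        with wrong \<open>B \<in> S\<close> show False by (auto simp: g'_def)
      qed
      \<comment> \<open>\<open>C(B := C B)\<close> is \<open>C\<close>, so with color
        \<open>x\<close> on \<open>L\<close> both \<open>L\<close> and \<open>B\<close> are
        wrong.\<close>
      then obtain x where x: "x \<in> hat_colors" "x \<noteq> g L C" "g B (C(L := x)) \<noteq> C B"
        by (auto simp: bad_def)
      let ?C = "C(L := x)"
      obtain v where v: "v \<in> insert L S" "g v ?C = ?C v"
        using g[of ?C] C x(1) P[OF \<open>P C\<close>] by (metis fun_upd_apply)
      show False
      proof (cases "v = L")
        case True
        have "g L ?C = g L C"
          by (rule local_onD[OF loc]) (use irr in \<open>auto simp: irrefl_def\<close>)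
        with True v x show False by simp
      next
        case False
        with v have "v \<in> S" by simp
        show False
        proof (cases "v = B")
          case True
          with v x False show False by simp
        next
          case vB: False
          then have "(v, L) \<notin> E" using leaf \<open>v \<in> S\<close> sym by (meson symD)
          then have "g v ?C = g v C" using \<open>v \<in> S\<close> by (intro local_onD[OF loc]) auto
          with v False vB wrong \<open>v \<in> S\<close> show False by (auto simp: g'_def)
        qed
      qed
    qed
  qed
qed

section \<open>Leaves in acyclic graphs\<close>

text \<open>On a longest path ending in \<open>r\<close>, a neighbour of the first vertex
  \<open>L\<close> other than \<open>B\<close> would either prolong the path or close a cycle with
  its initial segment.\<close>

lemma exists_leaf_reachable:
  assumes "finite S" and sym: "sym E" and irr: "irrefl E"
    and acyclic: "\<nexists>xs. closed_path E xs"
    and "r \<in> S" "y \<in> S" "(r, y) \<in> E"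
  obtains L B where "L \<in> S" "L \<noteq> r" "B \<in> S" "(L, B) \<in> E"
    "\<And>u. u \<in> S \<Longrightarrow> (L, u) \<in> E \<Longrightarrow> u = B"
proof -
  \<comment> \<open>The fixed end \<open>r\<close> comes last, so that paths grow at the head of the
    list.\<close>
  define path where "path xs \<longleftrightarrow> distinct xs \<and> set xs \<subseteq> S \<and> xs \<noteq> [] \<and> last xs = r \<and>
    successively (\<lambda>x y. (x, y) \<in> E) xs" for xs
  have "y \<noteq> r" using irr assms(7) by (auto simp: irrefl_def)
  then have start: "path [y, r]"
    using assms(5-7) sym by (auto simp: path_def dest: symD)
  have "length xs \<le> card S" if "path xs" for xs
    using that \<open>finite S\<close> unfolding path_def by (metis card_mono distinct_card)
  with start obtain xs where xs: "path xs" and max: "\<And>ys. path ys \<Longrightarrow> length ys \<le> length xs"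
    using ex_has_greatest_nat[of path "[y, r]" length "Suc (card S)"] by (auto simp: less_Suc_eq_le)
  from max[OF start] obtain L B ys where eq: "xs = L # B # ys"
    by (cases xs; cases "tl xs") auto
  have L: "L \<in> S" "B \<in> S" "(L, B) \<in> E" "L \<noteq> r"
    using xs by (auto simp: eq path_def split: if_splits)
  moreover have "u = B" if u: "u \<in> S" "(L, u) \<in> E" for u
  proof (rule ccontr)
    assume "u \<noteq> B"
    have "(u, L) \<in> E" using u sym by (auto dest: symD)
    have "u \<in> set xs"
    proof (rule ccontr)
      assume "u \<notin> set xs"
      then have "path (u # xs)"
        using xs u \<open>(u, L) \<in> E\<close> by (auto simp: path_def eq)
      from max[OF this] show False by simp
    qed
    moreover have "u \<noteq> L" using irr u by (auto simp: irrefl_def)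
    ultimately have "u \<in> set ys" using \<open>u \<noteq> B\<close> eq by auto
    then obtain as bs where ys: "ys = as @ u # bs" by (meson split_list)
    have "closed_path E (L # B # as @ [u])"
      using xs \<open>(u, L) \<in> E\<close>
      by (auto simp: closed_path_def path_def eq ys successively_append_iff
          successively_Cons hd_append split: if_splits)
    with acyclic show False by blast
  qed
  ultimately show ?thesis using that by blast
qed

text \<open>If \<open>A\<close> has a neighbour, a longest path ending in \<open>A\<close> starts at
  a leaf. Otherwise another vertex \<open>z\<close> is used: a leaf with a neighbour cannot be
  \<open>A\<close>. Allowing forests spares the induction a proof that connectedness
  survives.\<close>

lemma exists_leaf_avoiding:
  assumes "finite S" and sym: "sym E" and irr: "irrefl E"
    and acyclic: "\<nexists>xs. closed_path E xs"
    and "A \<in> S" "S \<noteq> {A}"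
  obtains L B where "L \<in> S" "L \<noteq> A" "B \<in> S - {L}"
    "\<And>u. u \<in> S \<Longrightarrow> (L, u) \<in> E \<Longrightarrow> u = B"
proof (cases "\<exists>y\<in>S. (A, y) \<in> E")
  case True
  then obtain y where "y \<in> S" "(A, y) \<in> E" by blast
  from exists_leaf_reachable[OF assms(1-5) this] obtain L B where
    *: "L \<in> S" "L \<noteq> A" "B \<in> S" "(L, B) \<in> E" "\<And>u. u \<in> S \<Longrightarrow> (L, u) \<in> E \<Longrightarrow> u = B"
    by blast
  moreover have "B \<noteq> L" using *(4) irr by (auto simp: irrefl_def)
  ultimately show ?thesis using that[of L B] by blast
next
  case A: False
  from assms obtain z where z: "z \<in> S" "z \<noteq> A" by blast
  show ?thesis
  proof (cases "\<exists>y\<in>S. (z, y) \<in> E")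
    case True
    then obtain y where "y \<in> S" "(z, y) \<in> E" by blast
    from exists_leaf_reachable[OF assms(1-4) z(1) this] obtain L B where
      *: "L \<in> S" "L \<noteq> z" "B \<in> S" "(L, B) \<in> E" "\<And>u. u \<in> S \<Longrightarrow> (L, u) \<in> E \<Longrightarrow> u = B"
      by blast
    moreover have "B \<noteq> L" "L \<noteq> A" using *(3,4) A irr by (auto simp: irrefl_def)
    ultimately show ?thesis using that[of L B] by blast
  next
    case False
    \<comment> \<open>The isolated vertex \<open>z\<close> counts as a leaf, with \<open>A\<close>
      as a nominal neighbour.\<close>
    then show ?thesis using that[of z A] z \<open>A \<in> S\<close> by blast
  qed
qed

lemma acyclic_imp_not_wins_on:
  assumes "finite S" "sym E" "irrefl E" "\<nexists>xs. closed_path E xs" "A \<in> S"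
  shows "\<not> wins_on E S (\<lambda>C. C A \<noteq> i)"
  using assms(1,5)
proof (induction S rule: finite_psubset_induct)
  case (psubset S)
  show ?case
  proof (cases "S = {A}")
    case True
    show ?thesis
    proof
      assume "wins_on E S (\<lambda>C. C A \<noteq> i)"
      then obtain g where loc: "local_on E S g"
        and g: "\<And>C. \<forall>u. C u \<in> hat_colors \<Longrightarrow> C A \<noteq> i \<Longrightarrow> \<exists>v\<in>S. g v C = C v"
        unfolding wins_on_def by blast
      \<comment> \<open>The only sage \<open>A\<close> sees nobody, so its guess is constant;
        \<open>c\<close> avoids both this guess and the hint.\<close>
      obtain c where c: "c \<in> hat_colors" "c \<noteq> i" "c \<noteq> g A (\<lambda>_. 0)"
        by (rule hat_color_avoiding)
      have "g A (\<lambda>_. c) = g A (\<lambda>_. 0)"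
        by (rule local_onD[OF loc]) (use True \<open>irrefl E\<close> in \<open>auto simp: irrefl_def\<close>)
      with g[of "\<lambda>_. c"] c True show False by simp
    qed
  next
    case False
    from exists_leaf_avoiding[OF \<open>finite S\<close> assms(2-4) \<open>A \<in> S\<close> this] obtain L B where
      L: "L \<in> S" "L \<noteq> A" "B \<in> S - {L}" "\<And>u. u \<in> S \<Longrightarrow> (L, u) \<in> E \<Longrightarrow> u = B"
      by blast
    have "\<not> wins_on E (S - {L}) (\<lambda>C. C A \<noteq> i)"
      using psubset.IH[of "S - {L}"] L psubset.prems by blast
    moreover have "wins_on E (S - {L}) (\<lambda>C. C A \<noteq> i)" if "wins_on E S (\<lambda>C. C A \<noteq> i)"
    proof (rule wins_on_remove_leaf[where L = L and B = B])
      show "wins_on E (insert L (S - {L})) (\<lambda>C. C A \<noteq> i)"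
        using that L by (simp add: insert_absorb)
      show "u = B" if "u \<in> S - {L}" "(L, u) \<in> E" for u using L(4)[of u] that by blast
    qed (use L(1-3) assms(2,3) in auto)
    ultimately show ?thesis by blast
  qed
qed

section \<open>Passing hints\<close>

text \<open>The added vertices guess a fixed value, and the old ones ignore them.\<close>

lemma wins_on_mono:
  assumes "wins_on E S P" "S \<subseteq> T"
  shows "wins_on E T P"
proof -
  from assms(1) obtain g where loc: "local_on E S g"
    and g: "\<And>C. \<forall>u. C u \<in> hat_colors \<Longrightarrow> P C \<Longrightarrow> \<exists>v\<in>S. g v C = C v"
    unfolding wins_on_def by blast
  show ?thesis
  proof (rule wins_onI[of T E "\<lambda>v C. if v \<in> S then g v C else 0"])
    fix v and C C' :: "'a \<Rightarrow> nat"
    assume eq: "\<And>u. u \<in> T \<Longrightarrow> (v, u) \<in> E \<Longrightarrow> C u = C' u"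
    have "g v C = g v C'" if "v \<in> S"
      by (rule local_onD[OF loc that]) (use eq \<open>S \<subseteq> T\<close> in blast)
    then show "(if v \<in> S then g v C else 0) = (if v \<in> S then g v C' else 0)"
      by simp
  next
    fix C :: "'a \<Rightarrow> nat" assume "\<And>u. C u \<in> hat_colors" "P C"
    with g[of C] \<open>S \<subseteq> T\<close>
    show "\<exists>v\<in>T. (if v \<in> S then g v C else 0) = C v" by auto
  qed
qed

text \<open>Let \<open>a\<close>, \<open>b\<close> be the colors left for \<open>A\<close>. If
  \<open>A\<close> wears \<open>a\<close>, then \<open>B\<close> guesses \<open>j\<close>;
  \<open>A\<close> guesses \<open>b\<close> on seeing \<open>j\<close> and \<open>a\<close>
  otherwise. Both fail only if \<open>A\<close> wears \<open>b\<close> and \<open>B\<close> does not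
  wear \<open>j\<close>, and then the old strategy applies. \<open>P\<close> carries along a hint
  elsewhere.\<close>

lemma wins_on_pass_hint:
  assumes win: "wins_on E S (\<lambda>C. C B \<noteq> j \<and> P C)"
    and "A \<notin> S" "B \<in> S" "(A, B) \<in> E" "(B, A) \<in> E" "i \<in> hat_colors"
  shows "wins_on E (insert A S) (\<lambda>C. C A \<noteq> i \<and> P C)"
proof -
  from win obtain g where loc: "local_on E S g"
    and g: "\<And>C. \<forall>u. C u \<in> hat_colors \<Longrightarrow> C B \<noteq> j \<and> P C \<Longrightarrow> \<exists>v\<in>S. g v C = C v"
    unfolding wins_on_def by blast
  obtain a b where ab: "a \<noteq> b" "\<And>c. c \<in> hat_colors \<Longrightarrow> c \<noteq> i \<Longrightarrow> c = a \<or> c = b"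
    using hat_colors_hint[OF \<open>i \<in> hat_colors\<close>] by blast
  define g' where "g' v C =
    (if v = A then if C B = j then b else a
     else if v = B \<and> C A = a then j else g v C)" for v C
  show ?thesis
  proof (rule wins_onI[of _ E g'])
    fix v and C C' :: "'a \<Rightarrow> nat"
    assume v: "v \<in> insert A S" and eq: "\<And>u. u \<in> insert A S \<Longrightarrow> (v, u) \<in> E \<Longrightarrow> C u = C' u"
    have "g v C = g v C'" if "v \<noteq> A"
      using v eq that by (intro local_onD[OF loc]) auto
    moreover have "C B = C' B" if "v = A" using that eq assms by auto
    moreover have "C A = C' A" if "v = B" using that eq assms by auto
    ultimately show "g' v C = g' v C'" unfolding g'_def by (cases "v = A"; cases "v = B") simp_all
  next
    fix C :: "'a \<Rightarrow> nat" assume C: "\<And>u. C u \<in> hat_colors" and hint: "C A \<noteq> i \<and> P C"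
    consider "C A = a" "C B = j" | "C A = a" "C B \<noteq> j" | "C A = b" "C B = j" | "C A = b" "C B \<noteq> j"
      using ab(2)[OF C[of A]] hint by blast
    then show "\<exists>v\<in>insert A S. g' v C = C v"
    proof cases
      case 1
      then show ?thesis using assms by (intro bexI[of _ B]) (auto simp: g'_def)
    next
      case 4
      with g[of C] C hint obtain v where "v \<in> S" "g v C = C v" by blast
      then show ?thesis using 4 ab assms by (intro bexI[of _ v]) (auto simp: g'_def)
    qed (auto simp: g'_def)
  qed
qed

text \<open>The same color \<open>a\<close> of \<open>A\<close> triggers the guess \<open>j\<close>
  at \<open>B\<close> and \<open>k\<close> at \<open>D\<close>, and \<open>A\<close> guesses
  \<open>b\<close> as soon as one of these two colors shows. What remains is \<open>A\<close>
  wearing \<open>b\<close>, with both hints valid.\<close>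

lemma wins_on_pass_two_hints:
  assumes win: "wins_on E S (\<lambda>C. C B \<noteq> j \<and> C D \<noteq> k)"
    and "A \<notin> S" "B \<in> S" "D \<in> S" "B \<noteq> D" "i \<in> hat_colors"
    and adj: "(A, B) \<in> E" "(B, A) \<in> E" "(A, D) \<in> E" "(D, A) \<in> E"
  shows "wins_on E (insert A S) (\<lambda>C. C A \<noteq> i)"
proof -
  from win obtain g where loc: "local_on E S g"
    and g: "\<And>C. \<forall>u. C u \<in> hat_colors \<Longrightarrow> C B \<noteq> j \<and> C D \<noteq> k \<Longrightarrow> \<exists>v\<in>S. g v C = C v"
    unfolding wins_on_def by blast
  obtain a b where ab: "a \<noteq> b" "\<And>c. c \<in> hat_colors \<Longrightarrow> c \<noteq> i \<Longrightarrow> c = a \<or> c = b"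
    using hat_colors_hint[OF \<open>i \<in> hat_colors\<close>] by blast
  define g' where "g' v C =
    (if v = A then if C B = j \<or> C D = k then b else a
     else if v = B \<and> C A = a then j
     else if v = D \<and> C A = a then k else g v C)" for v C
  show ?thesis
  proof (rule wins_onI[of _ E g'])
    fix v and C C' :: "'a \<Rightarrow> nat"
    assume v: "v \<in> insert A S" and eq: "\<And>u. u \<in> insert A S \<Longrightarrow> (v, u) \<in> E \<Longrightarrow> C u = C' u"
    have "g v C = g v C'" if "v \<noteq> A"
      using v eq that by (intro local_onD[OF loc]) auto
    moreover have "C B = C' B" "C D = C' D" if "v = A" using that eq assms by auto
    moreover have "C A = C' A" if "v = B \<or> v = D" using that eq assms by auto
    ultimately show "g' v C = g' v C'"
      unfolding g'_def by (cases "v = A"; cases "v = B"; cases "v = D") simp_all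
  next
    fix C :: "'a \<Rightarrow> nat" assume C: "\<And>u. C u \<in> hat_colors" and hint: "C A \<noteq> i"
    consider "C A = a" "C B = j" | "C A = a" "C D = k" | "C A = a" "\<not> (C B = j \<or> C D = k)"
      | "C A = b" "C B = j \<or> C D = k" | "C A = b" "C B \<noteq> j" "C D \<noteq> k"
      using ab(2)[OF C[of A]] hint by blast
    then show "\<exists>v\<in>insert A S. g' v C = C v"
    proof cases
      case 1
      then show ?thesis using assms by (intro bexI[of _ B]) (auto simp: g'_def)
    next
      case 2
      then show ?thesis using assms by (intro bexI[of _ D]) (auto simp: g'_def)
    next
      case 5
      with g[of C] C obtain v where "v \<in> S" "g v C = C v" by blast
      then show ?thesis using 5 ab assms by (intro bexI[of _ v]) (auto simp: g'_def)
    qed (auto simp: g'_def)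
  qed
qed

section \<open>Paths, cycles and connected graphs\<close>

text \<open>The hint at the head is passed along the path while the one at the end stays. In the
  last vertex two distinct colors are then excluded, which determines its color.\<close>

lemma wins_on_path:
  assumes "sym E" "xs \<noteq> []" "distinct xs" "successively (\<lambda>x y. (x, y) \<in> E) xs"
    and "i \<in> hat_colors" "k \<in> hat_colors" "length xs = 1 \<Longrightarrow> i \<noteq> k"
  shows "wins_on E (set xs) (\<lambda>C. C (hd xs) \<noteq> i \<and> C (last xs) \<noteq> k)"
  using assms(2-)
proof (induction xs arbitrary: i rule: induct_list012)
  case (2 x)
  obtain c where c: "c \<in> hat_colors" "c \<noteq> i" "c \<noteq> k" by (rule hat_color_avoiding)
  have "d = c" if "d \<in> hat_colors" "d \<noteq> i" "d \<noteq> k" for d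
    using that c 2 unfolding hat_colors_def by auto
  then show ?case by (intro wins_onI[of _ E "\<lambda>_ _. c"]) auto
next
  case (3 x y zs)
  \<comment> \<open>The color passed on is free; it differs from \<open>k\<close> in case the rest
    is a single vertex.\<close>
  obtain j where j: "j \<in> hat_colors" "j \<noteq> k" using hat_color_avoiding by metis
  have "wins_on E (set (y # zs)) (\<lambda>C. C y \<noteq> j \<and> C (last (y # zs)) \<noteq> k)"
    using "3.IH"(2)[of j] "3.prems" j by simp
  then have "wins_on E (insert x (set (y # zs))) (\<lambda>C. C x \<noteq> i \<and> C (last (y # zs)) \<noteq> k)"
    by (rule wins_on_pass_hint) (use "3.prems" \<open>sym E\<close> in \<open>auto dest: symD\<close>)
  then show ?case by simp
qed simp

lemma closed_path_rotate1:
  assumes "closed_path E xs"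
  shows "closed_path E (rotate1 xs)"
proof (cases xs)
  case (Cons x ys)
  with assms show ?thesis
    by (auto simp: closed_path_def successively_append_iff successively_Cons split: if_splits)
qed (use assms in simp)

text \<open>Any vertex of the cycle can thus be brought to the front.\<close>

lemma closed_path_rotate: "closed_path E xs \<Longrightarrow> closed_path E (rotate n xs)"
  by (induction n) (simp_all add: closed_path_rotate1)

text \<open>Removing \<open>v\<close> from the cycle leaves a path whose two ends are neighbours of
  \<open>v\<close>, and \<open>v\<close> passes a hint to each of them.\<close>

lemma wins_on_closed_path:
  assumes "closed_path E xs" "sym E" "v \<in> set xs" "i \<in> hat_colors"
  shows "wins_on E (set xs) (\<lambda>C. C v \<noteq> i)"
proof -
  obtain n where n: "n < length xs" "v = xs ! n" using assms(3) by (metis in_set_conv_nth)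
  have cp: "closed_path E (rotate n xs)" using assms(1) by (rule closed_path_rotate)
  moreover have "hd (rotate n xs) = v"
    using n hd_rotate_conv_nth[of xs n] by (cases xs) auto
  ultimately obtain ys where ys: "rotate n xs = v # ys"
    by (cases "rotate n xs") (auto simp: closed_path_def)
  \<comment> \<open>One color serves at both ends, as the path has at least two vertices.\<close>
  obtain k :: nat where k: "k \<in> hat_colors" by (rule hat_color_avoiding)
  have ne: "ys \<noteq> []" "length ys \<noteq> 1" using cp by (auto simp: ys closed_path_def)
  have "hd ys \<noteq> last ys"
    using cp ne unfolding ys closed_path_def by (cases ys) auto
  have "wins_on E (set ys) (\<lambda>C. C (hd ys) \<noteq> k \<and> C (last ys) \<noteq> k)"
    by (rule wins_on_path)
      (use assms cp ne k in \<open>auto simp: ys closed_path_def successively_Cons\<close>)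
  then have "wins_on E (insert v (set ys)) (\<lambda>C. C v \<noteq> i)"
  proof (rule wins_on_pass_two_hints)
    show "(v, hd ys) \<in> E" "(last ys, v) \<in> E"
      using cp ne by (auto simp: ys closed_path_def successively_Cons)
    then show "(hd ys, v) \<in> E" "(v, last ys) \<in> E" using \<open>sym E\<close> by (auto dest: symD)
  qed (use cp ne assms \<open>hd ys \<noteq> last ys\<close> in \<open>auto simp: ys closed_path_def\<close>)
  moreover have "insert v (set ys) = set xs" using ys by (metis list.simps(15) set_rotate)
  ultimately show ?thesis by simp
qed

text \<open>Take a largest set \<open>S\<close> containing \<open>K\<close> that wins with a hint at
  any of its vertices. If an edge leads from \<open>x\<close> in \<open>S\<close> to
  \<open>y\<close> outside, a hint at \<open>y\<close> can be passed to \<open>x\<close>, so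
  \<open>y\<close> could be added.\<close>

lemma wins_on_connected:
  assumes "finite V" "sym E" "K \<subseteq> V" "K \<noteq> {}"
    and K: "\<And>v i. v \<in> K \<Longrightarrow> i \<in> hat_colors \<Longrightarrow> wins_on E K (\<lambda>C. C v \<noteq> i)"
    and conn: "\<And>S. S \<noteq> {} \<Longrightarrow> S \<subset> V \<Longrightarrow> \<exists>x\<in>S. \<exists>y\<in>V - S. (x, y) \<in> E"
    and "A \<in> V" "i \<in> hat_colors"
  shows "wins_on E V (\<lambda>C. C A \<noteq> i)"
proof -
  define good where "good S \<longleftrightarrow> K \<subseteq> S \<and> S \<subseteq> V \<and>
    (\<forall>v\<in>S. \<forall>i\<in>hat_colors. wins_on E S (\<lambda>C. C v \<noteq> i))" for S
  have "good K" using assms by (auto simp: good_def)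
  moreover have "\<forall>S. good S \<longrightarrow> card S \<le> card V"
    using \<open>finite V\<close> by (auto simp: good_def card_mono)
  ultimately obtain S where S: "good S" and max: "\<And>T. good T \<Longrightarrow> card T \<le> card S"
    using ex_has_greatest_nat[of good K card "Suc (card V)"] by (auto simp: less_Suc_eq_le)
  have "S = V"
  proof (rule ccontr)
    assume "S \<noteq> V"
    with conn[of S] S \<open>K \<noteq> {}\<close> obtain x y where xy: "x \<in> S" "y \<in> V" "y \<notin> S" "(x, y) \<in> E"
      unfolding good_def by blast
    have "wins_on E (insert y S) (\<lambda>C. C v \<noteq> i)" if "v \<in> insert y S" "i \<in> hat_colors" for v i
    proof (cases "v = y")
      case True
      \<comment> \<open>The conjunct \<open>True\<close> stands for the condition \<open>P\<close>
        of \<open>wins_on_pass_hint\<close>.\<close>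
      have "wins_on E S (\<lambda>C. C x \<noteq> i \<and> True)"
        using S xy that by (simp add: good_def)
      from wins_on_pass_hint[OF this, of y i] show ?thesis
        using xy that True \<open>sym E\<close> by (auto dest: symD)
    next
      case False
      with S that have "wins_on E S (\<lambda>C. C v \<noteq> i)" by (simp add: good_def)
      then show ?thesis by (rule wins_on_mono) blast
    qed
    then have "good (insert y S)" using S xy by (auto simp: good_def)
    moreover have "finite S" using S \<open>finite V\<close> finite_subset by (auto simp: good_def)
    ultimately show False using max[of "insert y S"] xy by simp
  qed
  with S assms show ?thesis by (auto simp: good_def)
qed

section \<open>The game on a graph\<close>

lemma pcas_successively:
  assumes "pcas u p v" "set p \<subseteq> E"
  shows "successively (\<lambda>x y. (x, y) \<in> E) (u # map snd p) \<and> last (u # map snd p) = v"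
  using assms by (induction p arbitrary: u) (auto simp: successively_Cons hd_map)

lemma pcas_zip:
  "pcas u (zip (u # xs) (xs @ [v])) v"
  by (induction xs arbitrary: u) auto

lemma successively_zip:
  assumes "successively (\<lambda>x y. (x, y) \<in> E) (u # xs @ [v])"
  shows "set (zip (u # xs) (xs @ [v])) \<subseteq> E"
  using assms by (induction xs arbitrary: u) auto

context pair_graph
begin

lemma sym_parcs: "sym (parcs G)"
  using pair_sym_arcs by (simp add: symmetric_def)

lemma irrefl_parcs: "irrefl (parcs G)"
  using pair_no_loops by (force simp: irrefl_def)

text \<open>The heads of the arcs of a cycle form a vertex list of the same length; conversely, a
  vertex list zipped with its rotation gives the arcs.\<close>

lemma ex_cycle_iff_closed_path:
  "(\<exists>p. cycle p \<and> 3 \<le> length p) \<longleftrightarrow> (\<exists>xs. closed_path (parcs G) xs)"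
proof
  assume "\<exists>p. cycle p \<and> 3 \<le> length p"
  then obtain p u where p: "awalk u p u" "distinct (tl (pawalk_verts u p))" "3 \<le> length p"
    by (auto simp: cycle_def)
  then have cas: "pcas u p u" "set p \<subseteq> parcs G" by (auto simp: awalk_def)
  have ne: "p \<noteq> []" using p by auto
  have "distinct (map snd p)" using p ne awalk_verts_conv'[OF cas(1)] by simp
  moreover have "successively (\<lambda>x y. (x, y) \<in> parcs G) (u # map snd p)"
    and "last (map snd p) = u"
    using pcas_successively[OF cas] ne by auto
  ultimately have "closed_path (parcs G) (map snd p)"
    using p ne by (auto simp: closed_path_def successively_Cons)
  then show "\<exists>xs. closed_path (parcs G) xs" by blast
next
  assume "\<exists>xs. closed_path (parcs G) xs"
  then obtain u xs where xs: "closed_path (parcs G) (u # xs)"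
    by (metis closed_path_def list.exhaust list.size(3) not_numeral_le_zero)
  define p where "p = zip (u # xs) (xs @ [u])"
  have cas: "pcas u p u" unfolding p_def by (rule pcas_zip)
  have sub: "set p \<subseteq> parcs G"
    unfolding p_def using xs
    by (intro successively_zip)
      (auto simp: closed_path_def successively_append_iff successively_Cons split: if_splits)
  have len: "length p = length (u # xs)" by (simp add: p_def)
  then have ne: "p \<noteq> []" by auto
  have "map snd p = xs @ [u]" by (simp add: p_def)
  then have "distinct (tl (pawalk_verts u p))"
    using xs ne awalk_verts_conv'[OF cas] by (auto simp: closed_path_def)
  moreover have "u \<in> pverts G"
    using sub in_arcsD1 by (cases xs) (auto simp: p_def)
  ultimately have "cycle p" using cas sub ne by (auto simp: cycle_def awalk_def)
  then show "\<exists>p. cycle p \<and> 3 \<le> length p"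
    using xs len by (auto simp: closed_path_def)
qed

text \<open>Otherwise \<open>S\<close> is closed under arcs and contains all that is reachable from
  it; by symmetry of the arcs, connectedness makes this every vertex.\<close>

lemma connected_edge_leaving:
  assumes "Digraph_Component.connected (with_proj G)" "S \<noteq> {}" "S \<subset> pverts G"
  shows "\<exists>x\<in>S. \<exists>y\<in>pverts G - S. (x, y) \<in> parcs G"
proof (rule ccontr)
  assume closed: "\<not> ?thesis"
  from assms obtain u v where uv: "u \<in> S" "v \<in> pverts G" "v \<notin> S" by blast
  have "strongly_connected (with_proj G)"
    using symmetric_connected_imp_strongly_connected pair_sym_arcs assms(1) by blast
  then have "u \<rightarrow>\<^sup>*\<^bsub>with_proj G\<^esub> v"
    using uv assms(3) by (auto simp: strongly_connected_def)
  then have "(u, v) \<in> (parcs G)\<^sup>*" using reachable_rtranclI by fastforce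
  then have "v \<in> S"
    by (induction rule: rtrancl_induct) (use uv closed in_arcsD2 in blast)+
  with uv show False by simp
qed

text \<open>Placements and views are extensional functions in the game but total ones in
  \<open>wins_on\<close>; the translation restricts in one direction and pads with the color 0 in
  the other.\<close>

lemma sages_win_hint_iff:
  assumes "A \<in> pverts G"
  shows "sages_win_hint G A \<longleftrightarrow>
    (\<forall>i\<in>hat_colors. wins_on (parcs G) (pverts G) (\<lambda>C. C A \<noteq> i))"
proof -
  have "(\<exists>f\<in>strategies G. \<forall>C\<in>placements G.
      C A \<noteq> i \<longrightarrow> (\<exists>v\<in>pverts G. guesses_correctly G f C v))
    \<longleftrightarrow> wins_on (parcs G) (pverts G) (\<lambda>C. C A \<noteq> i)" (is "?L \<longleftrightarrow> ?R") for i
  proof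
    assume ?L
    then obtain f where f: "\<And>C. C \<in> placements G \<Longrightarrow> C A \<noteq> i \<Longrightarrow>
        \<exists>v\<in>pverts G. guesses_correctly G f C v" by blast
    show ?R
    proof (rule wins_onI[of _ _ "\<lambda>v C. f v (restrict C (neighbours G v))"])
      fix v and C C' :: "'a \<Rightarrow> nat"
      assume "\<And>u. u \<in> pverts G \<Longrightarrow> (v, u) \<in> parcs G \<Longrightarrow> C u = C' u"
      then have "restrict C (neighbours G v) = restrict C' (neighbours G v)"
        using in_arcsD2 by (intro restrict_ext) (auto simp: neighbours_def)
      then show "f v (restrict C (neighbours G v)) = f v (restrict C' (neighbours G v))"
        by simp
    next
      fix C :: "'a \<Rightarrow> nat" assume C: "\<And>u. C u \<in> hat_colors" "C A \<noteq> i"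
      have "restrict C (pverts G) \<in> placements G" using C by (auto simp: placements_def)
      then obtain v where v: "v \<in> pverts G" "guesses_correctly G f (restrict C (pverts G)) v"
        using f[of "restrict C (pverts G)"] C(2) assms by auto
      have "pverts G \<inter> neighbours G v = neighbours G v"
        using in_arcsD2 by (auto simp: neighbours_def)
      with v show "\<exists>v\<in>pverts G. f v (restrict C (neighbours G v)) = C v"
        by (auto simp: guesses_correctly_def)
    qed
  next
    assume ?R
    then obtain g where loc: "local_on (parcs G) (pverts G) g"
      and g: "\<And>C. \<forall>u. C u \<in> hat_colors \<Longrightarrow> C A \<noteq> i \<Longrightarrow> \<exists>v\<in>pverts G. g v C = C v"
      unfolding wins_on_def by blast
    \<comment> \<open>Replacing a guess that is no color by 0 puts \<open>f\<close> into
      \<open>strategies G\<close> and loses no correct guess.\<close>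
    define f where "f v c = (let x = g v (\<lambda>u. if u \<in> neighbours G v then c u else 0)
      in if x \<in> hat_colors then x else 0)" for v c
    have "f \<in> strategies G" by (auto simp: strategies_def f_def Let_def hat_colors_def)
    moreover have "\<exists>v\<in>pverts G. guesses_correctly G f C v"
      if C: "C \<in> placements G" "C A \<noteq> i" for C
    proof -
      \<comment> \<open>Padding with 0 makes every value a color, also off the graph.\<close>
      define D where "D u = (if u \<in> pverts G then C u else 0)" for u
      have D: "D u \<in> hat_colors" for u
        using PiE_mem[OF C(1)[unfolded placements_def], of u] by (simp add: D_def hat_colors_def)
      moreover have "D A \<noteq> i" using C assms by (simp add: D_def)
      ultimately obtain v where v: "v \<in> pverts G" "g v D = D v" using g by blast
      have "g v (\<lambda>u. if u \<in> neighbours G v then restrict C (neighbours G v) u else 0) = g v D"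
        by (rule local_onD[OF loc v(1)]) (auto simp: neighbours_def D_def)
      then have "f v (restrict C (neighbours G v)) = C v"
        using v D[of v] by (simp add: f_def Let_def) (simp add: D_def)
      with v show ?thesis by (auto simp: guesses_correctly_def)
    qed
    ultimately show ?L by blast
  qed
  then show ?thesis by (simp add: sages_win_hint_def)
qed

end

theorem theorem13:
  fixes G :: "'a pair_pre_digraph" and A :: 'a
  assumes "pair_graph G"
    and "Digraph_Component.connected (with_proj G)"
    and "A \<in> pverts G"
  shows "sages_lose_hint G A \<longleftrightarrow> undirected_tree G"
proof -
  interpret pair_graph G by fact
  have tree: "undirected_tree G \<longleftrightarrow> (\<nexists>xs. closed_path (parcs G) xs)"
    using assms(2) ex_cycle_iff_closed_path by (simp add: undirected_tree_def)
  show ?thesis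
  proof (cases "\<exists>xs. closed_path (parcs G) xs")
    case True
    then obtain xs where xs: "closed_path (parcs G) xs" by blast
    have "xs \<noteq> []" using xs by (auto simp: closed_path_def)
    \<comment> \<open>Rotated to the front, each vertex is the head of the closing arc, hence a
      vertex of \<open>G\<close>.\<close>
    have "set xs \<subseteq> pverts G"
    proof
      fix v assume v: "v \<in> set xs"
      then obtain n where n: "n < length xs" "v = xs ! n" by (metis in_set_conv_nth)
      then have "hd (rotate n xs) = v" using hd_rotate_conv_nth[of xs n] by (cases xs) auto
      then show "v \<in> pverts G"
        using closed_path_rotate[OF xs, of n] in_arcsD2 by (auto simp: closed_path_def)
    qed
    then have "wins_on (parcs G) (pverts G) (\<lambda>C. C A \<noteq> i)" if "i \<in> hat_colors" for i
      using wins_on_connected[OF pair_finite_verts sym_parcs, of "set xs" A i]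
        wins_on_closed_path[OF xs sym_parcs] connected_edge_leaving[OF assms(2)]
        \<open>xs \<noteq> []\<close> assms(3) that by auto
    then show ?thesis
      using True tree sages_win_hint_iff[OF assms(3)] by (simp add: sages_lose_hint_def)
  next
    case False
    \<comment> \<open>Winning requires a strategy for every announced color, so failing for the
      color 0 is enough.\<close>
    have "\<not> wins_on (parcs G) (pverts G) (\<lambda>C. C A \<noteq> 0)"
      by (rule acyclic_imp_not_wins_on[OF pair_finite_verts sym_parcs irrefl_parcs False assms(3)])
    moreover have "0 \<in> hat_colors" by (simp add: hat_colors_def)
    ultimately show ?thesis
      using False tree sages_win_hint_iff[OF assms(3)] by (auto simp: sages_lose_hint_def)
  qed
qed

end
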